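(* Let $G$ be a finitely generated, virtually abelian group. Then for every finite generating set $X$ of $G$, $\mathrm{cr}_X(G)>0$. More precisely, if $A\leqslant G$ is an abelian subgroup of finite index $[G:A]=m$, then $\mathrm{cr}_X(G)\geqslant 1/m^2$.
   Context: For a group $G$ with finite generating set $X$, $\mathbb{B}_{G,X}(n)$ is the ball of radius $n$ about the identity for the word length over $X\cup X^{-1}$, and $C_{G,X}(n)$ is the set of conjugacy classes of $G$ having a representative in $\mathbb{B}_{G,X}(n)$. The conjugacy ratio is $\mathrm{cr}_X(G)=\limsup_{n\to\infty}\frac{|C_{G,X}(n)|}{|\mathbb{B}_{G,X}(n)|}$. *)

theory Defs
  imports "HOL-Algebra.Generated_Groups" "HOL-Library.Extended_Real"
begin

definition finite_generating_set :: "('a, 'b) monoid_scheme \<Rightarrow> 'a set \<Rightarrow> bool" where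
  "finite_generating_set G S \<longleftrightarrow> finite S \<and> S \<subseteq> carrier G \<and> generate G S = carrier G"

definition finitely_generated_group :: "('a, 'b) monoid_scheme \<Rightarrow> bool" where
  "finitely_generated_group G \<longleftrightarrow> (\<exists>S. finite_generating_set G S)"

definition abelian_subgroup :: "'a set \<Rightarrow> ('a, 'b) monoid_scheme \<Rightarrow> bool" where
  "abelian_subgroup A G \<longleftrightarrow> subgroup A G \<and> comm_group (G\<lparr>carrier := A\<rparr>)"

definition has_finite_index :: "('a, 'b) monoid_scheme \<Rightarrow> 'a set \<Rightarrow> bool" where
  "has_finite_index G H \<longleftrightarrow> finite (rcosets\<^bsub>G\<^esub> H)"

(* 0 when the index is infinite, so only meaningful together with has_finite_index *)
definition subgroup_index :: "('a, 'b) monoid_scheme \<Rightarrow> 'a set \<Rightarrow> nat" where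
  "subgroup_index G H = card (rcosets\<^bsub>G\<^esub> H)"

definition virtually_abelian :: "('a, 'b) monoid_scheme \<Rightarrow> bool" where
  "virtually_abelian G \<longleftrightarrow> (\<exists>A. abelian_subgroup A G \<and> has_finite_index G A)"

definition word_value :: "('a, 'b) monoid_scheme \<Rightarrow> 'a list \<Rightarrow> 'a" where
  "word_value G w = foldr (\<otimes>\<^bsub>G\<^esub>) w \<one>\<^bsub>G\<^esub>"

(* If S generates G, the set of lengths minimised over is nonempty for every g in the
   carrier; the value of LEAST is unspecified otherwise. *)
definition word_length :: "('a, 'b) monoid_scheme \<Rightarrow> 'a set \<Rightarrow> 'a \<Rightarrow> nat" where
  "word_length G S g =
     (LEAST n. \<exists>w. set w \<subseteq> S \<union> set_inv\<^bsub>G\<^esub> S \<and> length w = n \<and> word_value G w = g)"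

definition word_ball :: "('a, 'b) monoid_scheme \<Rightarrow> 'a set \<Rightarrow> nat \<Rightarrow> 'a set" where
  "word_ball G S n = {g \<in> carrier G. word_length G S g \<le> n}"

definition conjugacy_class :: "('a, 'b) monoid_scheme \<Rightarrow> 'a \<Rightarrow> 'a set" where
  "conjugacy_class G g = (\<lambda>h. h \<otimes>\<^bsub>G\<^esub> g \<otimes>\<^bsub>G\<^esub> inv\<^bsub>G\<^esub> h) ` carrier G"

definition conjugacy_classes :: "('a, 'b) monoid_scheme \<Rightarrow> 'a set set" where
  "conjugacy_classes G = conjugacy_class G ` carrier G"

definition conjugacy_classes_ball :: "('a, 'b) monoid_scheme \<Rightarrow> 'a set \<Rightarrow> nat \<Rightarrow> 'a set set" where
  "conjugacy_classes_ball G S n = {c \<in> conjugacy_classes G. \<exists>g\<in>c. g \<in> word_ball G S n}"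

(* The limsup is taken in the extended reals because real is not a complete lattice. *)
definition conjugacy_ratio :: "('a, 'b) monoid_scheme \<Rightarrow> 'a set \<Rightarrow> ereal" where
  "conjugacy_ratio G S =
     limsup (\<lambda>n. ereal (real (card (conjugacy_classes_ball G S n)) / real (card (word_ball G S n))))"

end

theory Submission
  imports Defs "HOL-Algebra.FiniteProduct" "HOL-Real_Asymp.Real_Asymp"
begin

text \<open>
  Let \<open>A\<close> have index \<open>m\<close>. A class meeting \<open>A\<close> has at most \<open>m\<close> elements, since conjugation by a
  coset \<open>t A\<close> moves an element of \<open>A\<close> to a single place; hence \<open>|A \<inter> B(n)| \<le> m |C(n)|\<close>. Translating
  each coset into \<open>A\<close> gives \<open>|B(n)| \<le> m |A \<inter> B(n + r)|\<close> for a constant \<open>r\<close>, so that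
  \<open>|B(n)| \<le> m\<^sup>2 |C(n + r)|\<close>. By Schreier rewriting, \<open>B(n)\<close> grows polynomially, so for every
  \<open>c > 1\<close> there are arbitrarily large \<open>n\<close> with \<open>|B(n + r)| \<le> c |B(n)|\<close>; this bounds the limit
  superior below by \<open>1 / (m\<^sup>2 c)\<close>. Working with a limit superior avoids having to show that
  \<open>|A \<inter> B(n)| / |B(n)|\<close> converges to \<open>1 / m\<close>.
\<close>

section \<open>Limits superior under polynomial growth\<close>

text \<open>Otherwise \<open>b\<close> would gain a factor \<open>c\<close> every \<open>r\<close>
  steps from \<open>N\<close> on, hence grow exponentially along \<open>N + j * r\<close>, which the
  polynomial bound forbids.\<close>

lemma frequently_shift_le_of_polynomial_growth:
  fixes b :: "nat \<Rightarrow> real"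
  assumes pos: "\<And>n. b n \<ge> 1" and growth: "\<And>n. b n \<le> K * (real n + 1) ^ k" and c: "c > 1"
  shows "\<exists>n\<ge>N. b (n + r) \<le> c * b n"
proof (rule ccontr)
  assume "\<not> ?thesis"
  then have step: "c * b n \<le> b (n + r)" if "n \<ge> N" for n
    using that by force
  have lower: "c ^ j \<le> b (N + j * r)" for j
  proof (induction j)
    case (Suc j)
    have "c ^ Suc j \<le> c * b (N + j * r)"
      using Suc c by simp
    also have "\<dots> \<le> b (N + Suc j * r)"
      using step[of "N + j * r"] by (simp add: algebra_simps)
    finally show ?case .
  qed (use pos in simp)
  have K: "K > 0"
    using pos[of 0] growth[of 0] by simp
  have upper: "c ^ j \<le> K * (real N + real j * real r + 1) ^ k" for j
    using order_trans[OF lower growth, of j] by simp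
  have "(\<lambda>j. K * (real N + real j * real r + 1) ^ k / c ^ j) \<longlonglongrightarrow> 0"
  \<comment> \<open>The growth of the numerator in \<open>j\<close> changes when \<open>r\<close>
    vanishes, so the two limits are computed separately.\<close>
  proof (cases "r = 0")
    case True
    then show ?thesis using c by simp real_asymp
  next
    case False
    then have "real r > 0" by simp
    then show ?thesis using c K by real_asymp
  qed
  then have "eventually (\<lambda>j. K * (real N + real j * real r + 1) ^ k / c ^ j < 1) sequentially"
    by (rule order_tendstoD) simp
  then obtain j where "K * (real N + real j * real r + 1) ^ k / c ^ j < 1"
    by (auto simp: eventually_sequentially)
  with upper[of j] c show False
    by (simp add: field_simps)
qed

text \<open>Here \<open>b\<close> will count group elements and \<open>u\<close> conjugacy classes.
  Where \<open>b (n + r) \<le> c * b n\<close>, the shift by \<open>r\<close> costs only a factor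
  \<open>c\<close>; such indices occur arbitrarily late, and \<open>c\<close> may be taken as close
  to 1 as desired.\<close>

lemma limsup_ge_of_polynomial_growth:
  fixes b u :: "nat \<Rightarrow> real"
  assumes pos: "\<And>n. b n \<ge> 1" and growth: "\<And>n. b n \<le> K * (real n + 1) ^ k"
    and le: "\<And>n. q * b n \<le> u (n + r)" and q: "q \<ge> 0"
  shows "ereal q \<le> limsup (\<lambda>n. ereal (u n / b n))"
proof -
  have *: "ereal (q / c) \<le> limsup (\<lambda>n. ereal (u n / b n))" if c: "c > 1" for c
  proof (rule ccontr)
    assume "\<not> ?thesis"
    then have "\<forall>\<^sub>F n in sequentially. ereal (u n / b n) < ereal (q / c)"
      by (intro Limsup_lessD) simp
    moreover have "\<exists>\<^sub>F n in sequentially. ereal (q / c) \<le> ereal (u n / b n)"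
      unfolding frequently_sequentially
    proof
      fix N
      obtain n where n: "n \<ge> N" "b (n + r) \<le> c * b n"
        using frequently_shift_le_of_polynomial_growth[OF pos growth c] by blast
      have "q * b (n + r) \<le> c * (q * b n)"
        using mult_left_mono[OF n(2) q] by (simp add: algebra_simps)
      also have "\<dots> \<le> c * u (n + r)"
        using le c by simp
      finally have "q / c \<le> u (n + r) / b (n + r)"
        using pos[of "n + r"] c by (simp add: field_simps)
      \<comment> \<open>The ratio is controlled at the shifted index \<open>n + r\<close>, which is
        still at least \<open>N\<close>.\<close>
      with n(1) show "\<exists>n\<ge>N. ereal (q / c) \<le> ereal (u n / b n)"
        by (intro exI[of _ "n + r"]) simp
    qed
    ultimately show False
      by (simp add: frequently_def not_le)
  qed
  \<comment> \<open>The bounds for \<open>c = 1 + 1 / real (Suc i)\<close> all lie below one limit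
    superior, so their limit \<open>q\<close> does too.\<close>
  have "(\<lambda>i. ereal (q / (1 + 1 / real (Suc i)))) \<longlonglongrightarrow> ereal q"
    by (intro tendsto_ereal) real_asymp
  then show ?thesis
    by (rule LIMSEQ_le_const2) (use * in force)
qed

section \<open>Words and balls\<close>

context group
begin

abbreviation letters :: "'a set \<Rightarrow> 'a set" where
  "letters S \<equiv> S \<union> set_inv S"

text \<open>Once \<open>m_assoc\<close> has nested a product to the right, a factor and its inverse
  are no longer an isolated pair; these rules cancel them there.\<close>

lemma mult_inv_cancel:
  assumes "x \<in> carrier G" "y \<in> carrier G"
  shows "x \<otimes> (inv x \<otimes> y) = y" "inv x \<otimes> (x \<otimes> y) = y"
  using assms by (simp_all flip: m_assoc)

lemma letters_subset: "S \<subseteq> carrier G \<Longrightarrow> letters S \<subseteq> carrier G"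
  by (auto simp: SET_INV_def)

lemma finite_letters: "finite S \<Longrightarrow> finite (letters S)"
  by (simp add: SET_INV_def)

lemma word_value_closed [simp]: "set w \<subseteq> carrier G \<Longrightarrow> word_value G w \<in> carrier G"
  by (induction w) (auto simp: word_value_def)

lemma word_value_append:
  assumes "set v \<subseteq> carrier G" "set w \<subseteq> carrier G"
  shows "word_value G (v @ w) = word_value G v \<otimes> word_value G w"
  using assms
proof (induction v)
  case Nil
  then show ?case using word_value_closed[of w] by (simp add: word_value_def)
next
  case (Cons x v)
  then show ?case
    using word_value_closed[of v] word_value_closed[of w] by (simp add: word_value_def m_assoc)
qed

lemma generate_imp_word:
  assumes "S \<subseteq> carrier G" "g \<in> generate G S"
  shows "\<exists>w. set w \<subseteq> letters S \<and> word_value G w = g"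
  using assms(2)
proof induction
  case one
  show ?case by (intro exI[of _ "[]"]) (simp add: word_value_def)
next
  case (incl h)
  then show ?case using assms(1) by (intro exI[of _ "[h]"]) (auto simp: word_value_def)
next
  case (inv h)
  then show ?case using assms(1)
    by (intro exI[of _ "[inv h]"]) (auto simp: word_value_def SET_INV_def)
next
  case (eng g h)
  then obtain v w where "set v \<subseteq> letters S" "word_value G v = g"
    "set w \<subseteq> letters S" "word_value G w = h" by blast
  moreover from this have "word_value G (v @ w) = g \<otimes> h"
    using letters_subset[OF assms(1)] by (subst word_value_append) blast+
  ultimately show ?case
    by (intro exI[of _ "v @ w"]) simp
qed

text \<open>Since \<open>S\<close> generates the group, the minimum defining
  \<open>word_length\<close> is attained. Most facts about balls below are read off from words
  through this description.\<close>

lemma word_ball_eq: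
  assumes "finite_generating_set G S"
  shows "word_ball G S n = word_value G ` {w. set w \<subseteq> letters S \<and> length w \<le> n}"
proof (intro subset_antisym subsetI)
  fix g assume g: "g \<in> word_ball G S n"
  have "\<exists>k w. set w \<subseteq> letters S \<and> length w = k \<and> word_value G w = g"
    using generate_imp_word[of S g] assms g
    by (auto simp: finite_generating_set_def word_ball_def)
  then have "\<exists>w. set w \<subseteq> letters S \<and> length w = word_length G S g \<and> word_value G w = g"
    unfolding word_length_def by (rule LeastI_ex)
  then show "g \<in> word_value G ` {w. set w \<subseteq> letters S \<and> length w \<le> n}"
    using g by (auto simp: word_ball_def)
next
  fix g assume "g \<in> word_value G ` {w. set w \<subseteq> letters S \<and> length w \<le> n}"
  then obtain w where w: "set w \<subseteq> letters S" "length w \<le> n" "word_value G w = g" by auto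
  have "word_length G S g \<le> length w"
    unfolding word_length_def by (rule Least_le) (use w in blast)
  moreover have "g \<in> carrier G"
    using w letters_subset[of S] assms word_value_closed[of w]
    by (auto simp: finite_generating_set_def)
  ultimately show "g \<in> word_ball G S n"
    using w by (simp add: word_ball_def)
qed

lemma finite_word_ball:
  assumes "finite_generating_set G S"
  shows "finite (word_ball G S n)"
  unfolding word_ball_eq[OF assms]
  by (intro finite_imageI finite_lists_length_le finite_letters)
    (use assms in \<open>simp add: finite_generating_set_def\<close>)

lemma one_in_word_ball:
  assumes "finite_generating_set G S"
  shows "\<one> \<in> word_ball G S n"
  unfolding word_ball_eq[OF assms] by (rule image_eqI[of _ _ "[]"]) (auto simp: word_value_def)

lemma word_ball_mult:
  assumes "finite_generating_set G S" "g \<in> word_ball G S i" "h \<in> word_ball G S j"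
  shows "g \<otimes> h \<in> word_ball G S (i + j)"
proof -
  have S: "letters S \<subseteq> carrier G"
    using assms(1) letters_subset by (simp add: finite_generating_set_def)
  obtain v w where "set v \<subseteq> letters S" "word_value G v = g" "length v \<le> i"
    "set w \<subseteq> letters S" "word_value G w = h" "length w \<le> j"
    using assms(2,3) unfolding word_ball_eq[OF assms(1)] by blast
  moreover from this have "g \<otimes> h = word_value G (v @ w)"
    using S by (subst word_value_append) blast+
  ultimately show ?thesis
    unfolding word_ball_eq[OF assms(1)] by (intro image_eqI[of _ _ "v @ w"]) simp_all
qed

text \<open>Supplies the constant by which translation with finitely many representatives can
  enlarge a ball.\<close>

lemma finite_subset_word_ball:
  assumes S: "finite_generating_set G S" and T: "finite T" "T \<subseteq> carrier G"
  shows "\<exists>r. T \<subseteq> word_ball G S r"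
proof (intro exI subsetI)
  fix t assume "t \<in> T"
  then show "t \<in> word_ball G S (Max (word_length G S ` T))"
    using T by (auto simp: word_ball_def)
qed

section \<open>Transversals and translation into the subgroup\<close>

text \<open>The index counts right cosets, whereas conjugation calls for left ones. Inversion
  carries the right coset of \<open>x\<close> to the left coset of \<open>inv x\<close>, so inverses
  of right representatives represent the left cosets.\<close>

lemma left_transversal_exists:
  assumes A: "subgroup A G" "has_finite_index G A"
  obtains T where "finite T" "card T \<le> subgroup_index G A" "T \<subseteq> carrier G"
    "\<And>g. g \<in> carrier G \<Longrightarrow> \<exists>t\<in>T. inv t \<otimes> g \<in> A"
proof -
  define rep where "rep = (\<lambda>C. SOME x. x \<in> carrier G \<and> C = A #> x)"
  have rep: "rep C \<in> carrier G" "C = A #> rep C" if "C \<in> rcosets A" for C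
  proof -
    have "\<exists>x. x \<in> carrier G \<and> C = A #> x"
      using that by (auto simp: RCOSETS_def)
    from someI_ex[OF this] show "rep C \<in> carrier G" "C = A #> rep C"
      by (auto simp: rep_def)
  qed
  define T where "T = (\<lambda>C. inv (rep C)) ` (rcosets A)"
  have fin: "finite (rcosets A)"
    using A(2) by (simp add: has_finite_index_def)
  show thesis
  proof (rule that[of T])
    show "finite T" using fin by (simp add: T_def)
    show "card T \<le> subgroup_index G A"
      unfolding T_def subgroup_index_def by (rule card_image_le[OF fin])
    show "T \<subseteq> carrier G" using rep by (auto simp: T_def)
  next
    fix g assume g: "g \<in> carrier G"
    \<comment> \<open>The left coset of \<open>g\<close> is found by inverting the right coset of
      \<open>inv g\<close>.\<close>
    let ?C = "A #> inv g"
    have C: "?C \<in> rcosets A"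
      using g subgroup.subset[OF A(1)] by (intro rcosetsI) auto
    have "inv g \<in> A #> rep ?C"
      using rep(2)[OF C] rcos_self[of "inv g" A] A(1) g by simp
    then obtain a where a: "a \<in> A" "inv g = a \<otimes> rep ?C"
      by (auto simp: r_coset_def)
    have aG: "a \<in> carrier G" using a(1) subgroup.subset[OF A(1)] by auto
    have "rep ?C \<otimes> g = inv a"
    proof -
      have "a \<otimes> (rep ?C \<otimes> g) = \<one>"
        using a(2) g aG rep(1)[OF C] by (metis l_inv m_assoc)
      then show ?thesis
        using aG g rep(1)[OF C] by (metis inv_equality inv_comm m_closed)
    qed
    then have "inv (inv (rep ?C)) \<otimes> g \<in> A"
      using rep(1)[OF C] a(1) subgroup.m_inv_closed[OF A(1)] by simp
    then show "\<exists>t\<in>T. inv t \<otimes> g \<in> A"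
      unfolding T_def using C by blast
  qed
qed

text \<open>Writing \<open>g\<close> as \<open>t \<otimes> (inv t \<otimes> g)\<close> recovers it
  from a representative and an element of \<open>A\<close>, whose length exceeds that of
  \<open>g\<close> by at most \<open>r\<close>.\<close>

lemma card_word_ball_le_Int:
  assumes S: "finite_generating_set G S" and T: "finite T" "T \<subseteq> carrier G"
    and cover: "\<And>g. g \<in> carrier G \<Longrightarrow> \<exists>t\<in>T. inv t \<otimes> g \<in> A"
    and r: "m_inv G ` T \<subseteq> word_ball G S r"
  shows "card (word_ball G S n) \<le> card T * card (A \<inter> word_ball G S (r + n))"
proof -
  have "word_ball G S n \<subseteq> (\<lambda>(t, a). t \<otimes> a) ` (T \<times> (A \<inter> word_ball G S (r + n)))"
  proof
    fix g assume g: "g \<in> word_ball G S n"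
    then have gG: "g \<in> carrier G" by (simp add: word_ball_def)
    obtain t where t: "t \<in> T" "inv t \<otimes> g \<in> A" using cover[OF gG] by blast
    have "inv t \<otimes> g \<in> word_ball G S (r + n)"
      using word_ball_mult[OF S _ g] r t(1) by blast
    moreover have "g = t \<otimes> (inv t \<otimes> g)"
      using t(1) T(2) gG by (metis inv_solve_left m_closed inv_closed subsetD)
    ultimately show "g \<in> (\<lambda>(t, a). t \<otimes> a) ` (T \<times> (A \<inter> word_ball G S (r + n)))"
      using t by (intro image_eqI[of _ _ "(t, inv t \<otimes> g)"]) auto
  qed
  then have "card (word_ball G S n) \<le> card (T \<times> (A \<inter> word_ball G S (r + n)))"
    using T(1) finite_word_ball[OF S] by (intro surj_card_le) auto
  then show ?thesis by (simp add: card_cartesian_product)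
qed

section \<open>Conjugacy classes meeting the abelian subgroup\<close>

lemma abelian_subgroup_commute:
  assumes "abelian_subgroup A G" "x \<in> A" "y \<in> A"
  shows "x \<otimes> y = y \<otimes> x"
proof -
  interpret H: comm_group "G\<lparr>carrier := A\<rparr>"
    using assms(1) by (simp add: abelian_subgroup_def)
  show ?thesis using H.m_comm assms(2,3) by simp
qed

lemma abelian_subgroup_pow_closed:
  assumes "abelian_subgroup A G" "x \<in> A"
  shows "x [^] (k::nat) \<in> A"
proof -
  interpret H: comm_group "G\<lparr>carrier := A\<rparr>"
    using assms(1) by (simp add: abelian_subgroup_def)
  show ?thesis
    using H.nat_pow_closed[of x k] assms(2) nat_pow_consistent[of x k A] by simp
qed

text \<open>If \<open>h = t \<otimes> a\<close> with \<open>a\<close> in \<open>A\<close>, then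
  \<open>a\<close> commutes with \<open>g\<close> and drops out of the conjugate, so only the
  representative \<open>t\<close> matters.\<close>

lemma conjugacy_class_abelian_subset:
  assumes A: "abelian_subgroup A G" and T: "T \<subseteq> carrier G"
    and cover: "\<And>g. g \<in> carrier G \<Longrightarrow> \<exists>t\<in>T. inv t \<otimes> g \<in> A"
    and g: "g \<in> A"
  shows "conjugacy_class G g \<subseteq> (\<lambda>t. t \<otimes> g \<otimes> inv t) ` T"
proof
  fix x assume "x \<in> conjugacy_class G g"
  then obtain h where h: "h \<in> carrier G" "x = h \<otimes> g \<otimes> inv h"
    by (auto simp: conjugacy_class_def)
  have AG: "A \<subseteq> carrier G" using A subgroup.subset by (auto simp: abelian_subgroup_def)
  obtain t where t: "t \<in> T" "inv t \<otimes> h \<in> A" using cover[OF h(1)] by blast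
  define a where "a = inv t \<otimes> h"
  have c: "t \<in> carrier G" "a \<in> carrier G" "g \<in> carrier G" "a \<in> A"
    using t T AG g by (auto simp: a_def)
  have h_eq: "h = t \<otimes> a"
    using c h(1) by (simp add: a_def flip: m_assoc)
  have "x = t \<otimes> (a \<otimes> g) \<otimes> (inv a \<otimes> inv t)"
    using c by (simp add: h(2) h_eq inv_mult_group m_assoc mult_inv_cancel)
  also have "\<dots> = t \<otimes> (g \<otimes> a) \<otimes> (inv a \<otimes> inv t)"
    using abelian_subgroup_commute[OF A c(4) g] by simp
  also have "\<dots> = t \<otimes> g \<otimes> (a \<otimes> inv a) \<otimes> inv t"
    using c by (simp add: m_assoc mult_inv_cancel)
  also have "\<dots> = t \<otimes> g \<otimes> inv t"
    using c by simp
  finally show "x \<in> (\<lambda>t. t \<otimes> g \<otimes> inv t) ` T"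
    using t(1) by blast
qed

lemma self_in_conjugacy_class: "g \<in> carrier G \<Longrightarrow> g \<in> conjugacy_class G g"
  unfolding conjugacy_class_def by (rule image_eqI[of _ _ \<one>]) auto

lemma conjugacy_class_eqI:
  assumes "g \<in> carrier G" "x \<in> conjugacy_class G g"
  shows "conjugacy_class G x = conjugacy_class G g"
proof -
  obtain h where h: "h \<in> carrier G" "x = h \<otimes> g \<otimes> inv h"
    using assms(2) by (auto simp: conjugacy_class_def)
  show ?thesis
    unfolding conjugacy_class_def
  proof (intro subset_antisym image_subsetI)
    fix k assume k: "k \<in> carrier G"
    have "k \<otimes> x \<otimes> inv k = (k \<otimes> h) \<otimes> g \<otimes> inv (k \<otimes> h)"
      using k h assms(1) by (simp add: inv_mult_group m_assoc)
    then show "k \<otimes> x \<otimes> inv k \<in> (\<lambda>h. h \<otimes> g \<otimes> inv h) ` carrier G"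
      using k h(1) by blast
    have "k \<otimes> g \<otimes> inv k = (k \<otimes> inv h) \<otimes> x \<otimes> inv (k \<otimes> inv h)"
      using k h assms(1) by (simp add: inv_mult_group m_assoc mult_inv_cancel)
    then show "k \<otimes> g \<otimes> inv k \<in> (\<lambda>h. h \<otimes> x \<otimes> inv h) ` carrier G"
      using k h(1) by blast
  qed
qed

text \<open>A class meeting the ball is the class of an element of the ball. Finiteness matters
  because \<open>card\<close> is 0 on infinite sets, so comparing cardinalities by inclusion needs
  it.\<close>

lemma finite_conjugacy_classes_ball:
  assumes "finite_generating_set G S"
  shows "finite (conjugacy_classes_ball G S n)"
proof (rule finite_subset)
  show "conjugacy_classes_ball G S n \<subseteq> conjugacy_class G ` word_ball G S n"
  proof
    fix c assume "c \<in> conjugacy_classes_ball G S n"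
    then obtain g x where "g \<in> carrier G" "c = conjugacy_class G g" "x \<in> c" "x \<in> word_ball G S n"
      unfolding conjugacy_classes_ball_def conjugacy_classes_def by blast
    then show "c \<in> conjugacy_class G ` word_ball G S n"
      using conjugacy_class_eqI[of g x] by blast
  qed
qed (simp add: finite_word_ball[OF assms])

text \<open>The classes of the elements of \<open>A\<close> in the ball cover these elements, each
  class has at most \<open>card T\<close> members, and all of them are counted in
  \<open>conjugacy_classes_ball\<close>.\<close>

lemma card_Int_word_ball_le:
  assumes S: "finite_generating_set G S" and A: "abelian_subgroup A G"
    and T: "finite T" "T \<subseteq> carrier G"
    and cover: "\<And>g. g \<in> carrier G \<Longrightarrow> \<exists>t\<in>T. inv t \<otimes> g \<in> A"
  shows "card (A \<inter> word_ball G S n) \<le> card T * card (conjugacy_classes_ball G S n)"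
proof -
  let ?AB = "A \<inter> word_ball G S n" and ?C = "conjugacy_class G ` (A \<inter> word_ball G S n)"
  have fin: "finite ?AB" using finite_word_ball[OF S] by simp
  have classes: "finite c \<and> card c \<le> card T" if c: "c \<in> ?C" for c
  proof -
    obtain g where g: "g \<in> A" "c = conjugacy_class G g" using c by blast
    show ?thesis
      using conjugacy_class_abelian_subset[OF A T(2) cover g(1)] T(1) g(2)
      by (metis finite_imageI finite_subset surj_card_le)
  qed
  have "?AB \<subseteq> \<Union> ?C"
    using self_in_conjugacy_class by (auto simp: word_ball_def)
  then have "card ?AB \<le> card (\<Union> ?C)"
    using classes fin by (intro card_mono) auto
  also have "\<dots> \<le> (\<Sum>c\<in>?C. card c)"
    using classes by (intro card_Union_le_sum_card)
  also have "\<dots> \<le> card ?C * card T"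
    using classes sum_bounded_above[of ?C card "card T"] by simp
  also have "card ?C \<le> card (conjugacy_classes_ball G S n)"
    using self_in_conjugacy_class
    by (intro card_mono finite_conjugacy_classes_ball[OF S])
      (auto simp: conjugacy_classes_ball_def conjugacy_classes_def word_ball_def)
  finally show ?thesis by (simp add: mult.commute)
qed

section \<open>Polynomial growth by Schreier rewriting\<close>

text \<open>Commuting letters can be collected into powers. The product is formed in the structure
  restricted to \<open>A\<close>, since the laws of \<open>finprod\<close> are those of a
  commutative monoid.\<close>

lemma word_value_eq_finprod:
  assumes A: "abelian_subgroup A G" and Y: "finite Y" "Y \<subseteq> A" and ys: "set ys \<subseteq> Y"
  shows "word_value G ys = finprod (G\<lparr>carrier := A\<rparr>) (\<lambda>y. y [^] count_list ys y) Y"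
proof -
  interpret H: comm_group "G\<lparr>carrier := A\<rparr>"
    using A by (simp add: abelian_subgroup_def)
  show ?thesis
    using ys
  proof (induction ys)
    case Nil
    then show ?case
      using H.finprod_one[of Y] by (simp add: word_value_def)
  next
    case (Cons x xs)
    have x: "x \<in> Y" "x \<in> A" using Cons.prems Y(2) by auto
    have AG: "A \<subseteq> carrier G" using A subgroup.subset by (auto simp: abelian_subgroup_def)
    let ?F = "finprod (G\<lparr>carrier := A\<rparr>)"
    \<comment> \<open>The new letter becomes a product over \<open>Y\<close> with at most one
      nontrivial factor, so that \<open>finprod_multf\<close> can merge it with the powers already
      collected.\<close>
    have x_eq: "?F (\<lambda>y. if x = y then y else \<one>) Y = x"
      using H.finprod_singleton[of x Y "\<lambda>y. y"] x Y by (simp add: subset_iff cong: if_cong)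
    have "word_value G (x # xs)
        = ?F (\<lambda>y. if x = y then y else \<one>) Y \<otimes> ?F (\<lambda>y. y [^] count_list xs y) Y"
      using Cons by (simp add: word_value_def x_eq)
    also have "\<dots> = ?F (\<lambda>y. (if x = y then y else \<one>) \<otimes> y [^] count_list xs y) Y"
      using H.finprod_multf[of "\<lambda>y. if x = y then y else \<one>" Y "\<lambda>y. y [^] count_list xs y"]
        Y(2) abelian_subgroup_pow_closed[OF A] H.one_closed by (auto simp: Pi_def subset_iff)
    also have "\<dots> = ?F (\<lambda>y. y [^] count_list (x # xs) y) Y"
    proof (rule H.finprod_cong')
      show "(\<lambda>y. y [^] count_list (x # xs) y) \<in> Y \<rightarrow> carrier (G\<lparr>carrier := A\<rparr>)"
        using Y(2) abelian_subgroup_pow_closed[OF A] by auto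
      fix y assume "y \<in> Y"
      then have "y \<in> carrier G" using Y(2) AG by auto
      then show "(if x = y then y else \<one>) \<otimes> y [^] count_list xs y = y [^] count_list (x # xs) y"
        using nat_pow_Suc2[of y "count_list xs y"] by simp
    qed simp
    finally show ?case .
  qed
qed

text \<open>Each exponent lies between 0 and \<open>n\<close>, hence \<open>n + 1\<close> choices
  per letter: the source of the polynomial bound.\<close>

lemma card_word_values_abelian_le:
  assumes A: "abelian_subgroup A G" and Y: "finite Y" "Y \<subseteq> A"
  shows "card (word_value G ` {ys. set ys \<subseteq> Y \<and> length ys \<le> n}) \<le> (n + 1) ^ card Y"
proof -
  let ?f = "\<lambda>k. finprod (G\<lparr>carrier := A\<rparr>) (\<lambda>y. y [^] (k y :: nat)) Y"
  interpret H: comm_group "G\<lparr>carrier := A\<rparr>"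
    using A by (simp add: abelian_subgroup_def)
  \<comment> \<open>the value of a word over commuting letters depends only on its letter counts\<close>
  have "word_value G ` {ys. set ys \<subseteq> Y \<and> length ys \<le> n} \<subseteq> ?f ` (Y \<rightarrow>\<^sub>E {..n})"
  proof (intro image_subsetI)
    fix ys assume "ys \<in> {ys. set ys \<subseteq> Y \<and> length ys \<le> n}"
    then have ys: "set ys \<subseteq> Y" "length ys \<le> n" by auto
    \<comment> \<open>Restricting the exponents to \<open>Y\<close> puts them into the finite
      extensional function space counted by \<open>card_PiE\<close>.\<close>
    have "word_value G ys = ?f (restrict (count_list ys) Y)"
      unfolding word_value_eq_finprod[OF A Y ys(1)]
      by (rule H.finprod_cong') (use Y(2) abelian_subgroup_pow_closed[OF A] in auto)
    moreover have "restrict (count_list ys) Y \<in> Y \<rightarrow>\<^sub>E {..n}"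
      using ys(2) count_le_length[of ys] by (auto intro: order_trans)
    ultimately show "word_value G ys \<in> ?f ` (Y \<rightarrow>\<^sub>E {..n})" by blast
  qed
  then have "card (word_value G ` {ys. set ys \<subseteq> Y \<and> length ys \<le> n}) \<le> card (Y \<rightarrow>\<^sub>E {..n})"
    using Y(1) by (intro surj_card_le finite_PiE) auto
  then show ?thesis
    using Y(1) by (simp add: card_PiE)
qed

text \<open>Reading the word from the right, a representative \<open>t\<close> is carried past each
  letter: \<open>s \<otimes> t = t' \<otimes> y\<close>, where \<open>y\<close> is a Schreier
  generator of \<open>A\<close>. The empty word starts this off as
  \<open>t0 \<otimes> (\<one> \<otimes> inv t0)\<close>, so \<open>t0\<close> may be any
  representative of the coset \<open>A\<close>, not just the identity.\<close>

lemma word_value_schreier: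
  assumes A: "subgroup A G" and T: "T \<subseteq> carrier G"
    and cover: "\<And>g. g \<in> carrier G \<Longrightarrow> \<exists>t\<in>T. inv t \<otimes> g \<in> A"
    and L: "L \<subseteq> carrier G"
    and Y: "Y = A \<inter> (\<lambda>(t', s, t). inv t' \<otimes> (s \<otimes> t)) ` (T \<times> L \<times> T)"
    and t0: "t0 \<in> T" "inv t0 \<in> A" and w: "set w \<subseteq> L"
  shows "\<exists>t\<in>T. \<exists>ys. set ys \<subseteq> Y \<and> length ys = length w \<and>
    word_value G w = t \<otimes> (word_value G ys \<otimes> inv t0)"
  using w
proof (induction w)
  case Nil
  then show ?case
    using t0 T by (intro bexI[of _ t0] exI[of _ "[]"]) (auto simp: word_value_def)
next
  case (Cons s w)
  then obtain t ys where IH: "t \<in> T" "set ys \<subseteq> Y" "length ys = length w"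
    "word_value G w = t \<otimes> (word_value G ys \<otimes> inv t0)" by auto
  have YG: "Y \<subseteq> carrier G" using Y subgroup.subset[OF A] by auto
  have c: "s \<in> carrier G" "t \<in> carrier G" "inv t0 \<in> carrier G" "word_value G ys \<in> carrier G"
    using Cons.prems L IH T t0 YG word_value_closed[of ys] by auto
  obtain t' where t': "t' \<in> T" "inv t' \<otimes> (s \<otimes> t) \<in> A"
    using cover[of "s \<otimes> t"] c by auto
  have c': "t' \<in> carrier G" using t' T by auto
  define y where "y = inv t' \<otimes> (s \<otimes> t)"
  have y: "y \<in> Y" using t' IH(1) Cons.prems by (force simp: y_def Y)
  have yG: "y \<in> carrier G" using y YG by auto
  have st: "s \<otimes> t = t' \<otimes> y"
    using c c' by (simp add: y_def flip: m_assoc)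
  have "word_value G (s # w) = s \<otimes> word_value G w"
    by (simp add: word_value_def)
  also have "\<dots> = (s \<otimes> t) \<otimes> (word_value G ys \<otimes> inv t0)"
    using c by (simp add: IH(4) m_assoc)
  also have "\<dots> = t' \<otimes> (y \<otimes> word_value G ys \<otimes> inv t0)"
    using c c' yG by (simp add: st m_assoc)
  also have "y \<otimes> word_value G ys = word_value G (y # ys)"
    by (simp add: word_value_def)
  finally show ?case
    using t'(1) y IH(2,3) by (intro bexI[of _ t'] exI[of _ "y # ys"]) auto
qed

text \<open>Rewriting leaves \<open>card T\<close> choices for the representative and polynomially
  many values in \<open>A\<close>. The degree is the number of Schreier generators, independent of
  \<open>n\<close>.\<close>

lemma virtually_abelian_polynomial_growth:
  assumes S: "finite_generating_set G S" and A: "abelian_subgroup A G"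
    and T: "finite T" "T \<subseteq> carrier G"
    and cover: "\<And>g. g \<in> carrier G \<Longrightarrow> \<exists>t\<in>T. inv t \<otimes> g \<in> A"
  shows "\<exists>k. \<forall>n. card (word_ball G S n) \<le> card T * (n + 1) ^ k"
proof -
  have subA: "subgroup A G" using A by (simp add: abelian_subgroup_def)
  define Y where "Y = A \<inter> (\<lambda>(t', s, t). inv t' \<otimes> (s \<otimes> t)) ` (T \<times> letters S \<times> T)"
  have L: "letters S \<subseteq> carrier G" "finite (letters S)"
    using S letters_subset finite_letters by (auto simp: finite_generating_set_def)
  have Y: "finite Y" "Y \<subseteq> A" using T(1) L(2) by (auto simp: Y_def)
  \<comment> \<open>Covering the identity yields the representative of \<open>A\<close>
    itself.\<close>
  obtain t0 where t0: "t0 \<in> T" "inv t0 \<in> A"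
    using cover[of \<one>] T(2) by (metis inv_closed one_closed r_one subsetD)
  have "card (word_ball G S n) \<le> card T * (n + 1) ^ card Y" for n
  proof -
    let ?P = "word_value G ` {ys. set ys \<subseteq> Y \<and> length ys \<le> n}"
    have "word_ball G S n \<subseteq> (\<lambda>(t, p). t \<otimes> (p \<otimes> inv t0)) ` (T \<times> ?P)"
    proof
      fix g assume "g \<in> word_ball G S n"
      then obtain w where w: "set w \<subseteq> letters S" "length w \<le> n" "g = word_value G w"
        unfolding word_ball_eq[OF S] by blast
      obtain t ys where t: "t \<in> T" "set ys \<subseteq> Y" "length ys = length w"
        "word_value G w = t \<otimes> (word_value G ys \<otimes> inv t0)"
        using word_value_schreier[OF subA T(2) cover L(1) Y_def t0 w(1)] by blast
      then show "g \<in> (\<lambda>(t, p). t \<otimes> (p \<otimes> inv t0)) ` (T \<times> ?P)"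
        using w by (intro image_eqI[of _ _ "(t, word_value G ys)"]) auto
    qed
    then have "card (word_ball G S n) \<le> card (T \<times> ?P)"
      using T(1) Y(1) finite_lists_length_le[of Y n] by (intro surj_card_le) auto
    also have "\<dots> \<le> card T * (n + 1) ^ card Y"
      unfolding card_cartesian_product using card_word_values_abelian_le[OF A Y]
      by (intro mult_le_mono2)
    finally show ?thesis .
  qed
  then show ?thesis by blast
qed

section \<open>The lower bound for the conjugacy ratio\<close>

text \<open>\<open>A\<close> itself is a coset. This excludes \<open>m = 0\<close>, where
  \<open>1 / m\<^sup>2\<close> would have the value 0 and give no positive bound.\<close>

lemma subgroup_index_pos:
  assumes "subgroup A G" "has_finite_index G A"
  shows "subgroup_index G A > 0"
proof -
  have "A #> \<one> \<in> rcosets A"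
    using subgroup.subset[OF assms(1)] by (intro rcosetsI) auto
  then show ?thesis
    using assms(2) by (auto simp: subgroup_index_def has_finite_index_def card_gt_0_iff)
qed

lemma conjugacy_ratio_ge:
  assumes S: "finite_generating_set G S" and A: "abelian_subgroup A G" "has_finite_index G A"
  shows "ereal (1 / (real (subgroup_index G A))\<^sup>2) \<le> conjugacy_ratio G S"
proof -
  define m where "m = subgroup_index G A"
  have subA: "subgroup A G" using A by (simp add: abelian_subgroup_def)
  have m: "m > 0" using subgroup_index_pos[OF subA A(2)] by (simp add: m_def)
  obtain T where T: "finite T" "card T \<le> m" "T \<subseteq> carrier G"
    and cover: "\<And>g. g \<in> carrier G \<Longrightarrow> \<exists>t\<in>T. inv t \<otimes> g \<in> A"
    using left_transversal_exists[OF subA A(2)] unfolding m_def by blast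
  \<comment> \<open>Cosets are moved into \<open>A\<close> by multiplying with \<open>inv t\<close>,
    so the lengths of the inverses are what must be bounded.\<close>
  obtain r where r: "m_inv G ` T \<subseteq> word_ball G S r"
    using finite_subset_word_ball[OF S, of "m_inv G ` T"] T by auto
  obtain k where k: "\<And>n. card (word_ball G S n) \<le> card T * (n + 1) ^ k"
    using virtually_abelian_polynomial_growth[OF S A(1) T(1,3) cover] by blast
  \<comment> \<open>One factor \<open>card T\<close> comes from translating cosets into
    \<open>A\<close>, the other from the size of the classes meeting \<open>A\<close>; each is at
    most \<open>m\<close>.\<close>
  have "card (word_ball G S n) \<le> m\<^sup>2 * card (conjugacy_classes_ball G S (n + r))" for n
  proof -
    have "card (word_ball G S n) \<le> card T * card (A \<inter> word_ball G S (r + n))"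
      by (rule card_word_ball_le_Int[OF S T(1,3) cover r])
    also have "\<dots> \<le> card T * (card T * card (conjugacy_classes_ball G S (r + n)))"
      by (intro mult_le_mono2 card_Int_word_ball_le[OF S A(1) T(1,3) cover])
    also have "\<dots> \<le> m * (m * card (conjugacy_classes_ball G S (r + n)))"
      using T(2) by (intro mult_le_mono) auto
    finally show ?thesis by (simp add: power2_eq_square add.commute mult.assoc)
  qed
  then have "1 / (real m)\<^sup>2 * real (card (word_ball G S n))
      \<le> real (card (conjugacy_classes_ball G S (n + r)))" for n
    using m by (simp add: field_simps flip: of_nat_mult of_nat_power)
  \<comment> \<open>The identity lies in every ball, and balls are finite, so no ratio has
    denominator 0.\<close>
  moreover have "1 \<le> real (card (word_ball G S n))" for n
    using one_in_word_ball[OF S, of n] finite_word_ball[OF S, of n]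
    by (metis One_nat_def Suc_leI card_gt_0_iff empty_iff of_nat_1 of_nat_le_iff)
  moreover have "real (card (word_ball G S n)) \<le> real (card T) * (real n + 1) ^ k" for n
  proof -
    have "real (card (word_ball G S n)) \<le> real (card T * (n + 1) ^ k)"
      using k by (simp only: of_nat_le_iff)
    then show ?thesis by (simp add: add.commute)
  qed
  ultimately show ?thesis
    unfolding conjugacy_ratio_def m_def[symmetric]
    by (intro limsup_ge_of_polynomial_growth) auto
qed

end

theorem proposition3p4:
  fixes G :: "('a, 'b) monoid_scheme"
  assumes "group G"
    and "finitely_generated_group G"
    and "virtually_abelian G"
  shows "(\<forall>S. finite_generating_set G S \<longrightarrow> conjugacy_ratio G S > 0) \<and>
    (\<forall>S A m. finite_generating_set G S \<longrightarrow>
       abelian_subgroup A G \<longrightarrow> has_finite_index G A \<longrightarrow> subgroup_index G A = m \<longrightarrow>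
       conjugacy_ratio G S \<ge> ereal (1 / (real m)\<^sup>2))"
proof -
  interpret group G by fact
  \<comment> \<open>Positivity mentions no subgroup; a single \<open>A\<close>, chosen before
    \<open>S\<close>, serves all generating sets.\<close>
  obtain A where A: "abelian_subgroup A G" "has_finite_index G A"
    using assms(3) by (auto simp: virtually_abelian_def)
  then have "subgroup_index G A > 0"
    by (simp add: subgroup_index_pos abelian_subgroup_def)
  then have "0 < ereal (1 / (real (subgroup_index G A))\<^sup>2)"
    by simp
  then have "conjugacy_ratio G S > 0" if "finite_generating_set G S" for S
    using conjugacy_ratio_ge[OF that A] by (rule less_le_trans)
  then show ?thesis
    using conjugacy_ratio_ge by blast
qed

end
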